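(* Let $n=2^d$ for some integer $d\geq 3$. Then \[h_1(\Delta^{[n]})-\frac{n}{3}\;\leq\;\frac{4n}{3(n^2-8)}=\frac{4}{3n}+\frac{32}{3n(n^2-8)}=\frac{1}{3}\left(4n^{-1}+32n^{-3}+256n^{-5}+\dots\right),\] where the last expression is the convergent series $\frac13\sum_{k\ge 0}4\cdot 8^k\, n^{-(2k+1)}$.
   Context: $[n]=\{1,\dots,n\}$ and $\Delta^{[n]}$ denotes the full simplex on the vertex set $[n]$ (all subsets of $[n]$ are simplices). For a finite simplicial complex $X$, let $C^k(X)$ be the $k$-cochains with $\mathbb{Z}_2$-coefficients, and let $\partial^*$ be the coboundary operator. For a cochain $c$, the norm $\|c\|$ is the number of $k$-simplices on which $c$ takes the value $1$. The cosystolic norm of a $k$-cochain $c$ is $\|c\|_{\mathrm{csy}}:=\min_{d\in C^{k-1}(X)}\|c+\partial^* d\|$. The $k$-th Cheeger constant of $X$ is $h_k(X):=\min_c \|\partial^* c\|/\|c\|_{\mathrm{csy}}$, where the minimum is taken over all $c\in C^k(X)$ which are not coboundaries. *)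

theory Defs
  imports Complex_Main "HOL-Library.Z2"
begin

(* Complexes are abstract and given by their set of simplices. *)

definition finite_simplicial_complex :: "'a set set \<Rightarrow> bool" where
  "finite_simplicial_complex X \<longleftrightarrow>
     finite X \<and> (\<forall>\<sigma>\<in>X. finite \<sigma>) \<and> (\<forall>\<sigma>\<in>X. \<forall>\<tau>. \<tau> \<subseteq> \<sigma> \<longrightarrow> \<tau> \<in> X)"

definition full_simplex :: "'a set \<Rightarrow> 'a set set" where
  "full_simplex V = Pow V"

(* Dimensions are integers, since the empty set is a simplex of dimension -1. *)
definition simplices :: "'a set set \<Rightarrow> int \<Rightarrow> 'a set set" where
  "simplices X k = {\<sigma> \<in> X. int (card \<sigma>) = k + 1}"

(* A cochain vanishes off the k-simplices, so that equal cochains are equal functions and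
   a finite complex has only finitely many cochains; the minima below rely on this. *)
definition cochains :: "'a set set \<Rightarrow> int \<Rightarrow> ('a set \<Rightarrow> bit) set" where
  "cochains X k = {c. \<forall>\<sigma>. \<sigma> \<notin> simplices X k \<longrightarrow> c \<sigma> = 0}"

(* The coboundary operator from k-cochains to (k+1)-cochains. *)
definition coboundary :: "'a set set \<Rightarrow> int \<Rightarrow> ('a set \<Rightarrow> bit) \<Rightarrow> ('a set \<Rightarrow> bit)" where
  "coboundary X k c =
     (\<lambda>\<tau>. if \<tau> \<in> simplices X (k + 1) then (\<Sum>\<sigma> | \<sigma> \<in> simplices X k \<and> \<sigma> \<subseteq> \<tau>. c \<sigma>) else 0)"

definition coboundaries :: "'a set set \<Rightarrow> int \<Rightarrow> ('a set \<Rightarrow> bit) set" where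
  "coboundaries X k = coboundary X (k - 1) ` cochains X (k - 1)"

definition cochain_norm :: "'a set set \<Rightarrow> int \<Rightarrow> ('a set \<Rightarrow> bit) \<Rightarrow> nat" where
  "cochain_norm X k c = card {\<sigma> \<in> simplices X k. c \<sigma> = 1}"

definition csy_norm :: "'a set set \<Rightarrow> int \<Rightarrow> ('a set \<Rightarrow> bit) \<Rightarrow> nat" where
  "csy_norm X k c =
     Min ((\<lambda>d. cochain_norm X k (\<lambda>\<sigma>. c \<sigma> + coboundary X (k - 1) d \<sigma>)) ` cochains X (k - 1))"

(* Meaningful only if some k-cochain is not a coboundary; otherwise this is Min {}. *)
definition cheeger :: "int \<Rightarrow> 'a set set \<Rightarrow> real" where
  "cheeger k X =
     Min ((\<lambda>c. real (cochain_norm X (k + 1) (coboundary X k c)) / real (csy_norm X k c))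
            ` (cochains X k - coboundaries X k))"

lemma finite_simplicial_complex_full_simplex:
  "finite V \<Longrightarrow> finite_simplicial_complex (full_simplex V)"
  by (auto simp: finite_simplicial_complex_def full_simplex_def dest: finite_subset)

lemma finite_cochains:
  assumes "finite_simplicial_complex X"
  shows "finite (cochains X k)"
proof -
  have "finite (simplices X k)"
    using assms by (simp add: finite_simplicial_complex_def simplices_def)
  then have "finite {c. \<forall>\<sigma>. (\<sigma> \<in> simplices X k \<longrightarrow> c \<sigma> \<in> (UNIV :: bit set)) \<and>
                         (\<sigma> \<notin> simplices X k \<longrightarrow> c \<sigma> = 0)}"
  proof (rule finite_set_of_finite_funs)
    have "(UNIV :: bit set) = {0, 1}"
      by (auto intro: bit.exhaust)
    then show "finite (UNIV :: bit set)"
      by (metis finite.emptyI finite.insertI)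
  qed
  then show ?thesis
    by (simp add: cochains_def)
qed

lemma zero_in_cochains: "(\<lambda>_. 0) \<in> cochains X k"
  by (simp add: cochains_def)

lemma coboundaries_subset_cochains: "coboundaries X k \<subseteq> cochains X k"
  by (auto simp: coboundaries_def coboundary_def cochains_def)

end

theory Submission
  imports Defs "HOL-Library.Disjoint_Sets"
begin

text \<open>
  A 1-cochain of the full simplex on \<open>n\<close> points is a graph; its coboundary is the set of triples
  spanning an odd number of edges (the odd triangles), and its cosystolic norm is the least number
  of edges in its switching class. So it suffices to find one graph with few odd triangles that no
  switching makes smaller. The bound to reach is \<open>n (n\<^sup>2 - 4) / (3 (n\<^sup>2 - 8))\<close>,
  which is \<open>n / 3 + 4 n / (3 (n\<^sup>2 - 8))\<close>, and a suitable graph exists for every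
  \<open>n = 4 q\<close>.

  Arrange the points in a row of blocks \<open>0, 1, \<dots>, 2 q\<close>, the blocks \<open>0\<close>
  and \<open>1\<close> having one point and all others two, and join a point of an even block to
  every point of every later odd block. This is a bipartite staircase graph. A triple is odd exactly if
  its blocks, in increasing order, alternate in parity.

  For the cosystolic norm (\<open>card_arcs_le_csy_norm\<close>), attach to each edge a cycle of
  length 3 or 4 in the complete graph that contains this edge and no other edge of the graph, in
  such a way that no pair of points lies on two of the cycles. Switching preserves the parity of the
  number of edges on a cycle, so each graph in the switching class has an edge on each of these
  cycles, and therefore at least as many edges as the staircase graph. For a graph with blocks of
  size one the cycle of the edge from \<open>x\<close> to \<open>y\<close> would be
  \<open>x, y, y - x, y + 1\<close>; doubling the blocks turns one such cycle into four disjoint ones,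
  and the single points in the blocks \<open>0\<close> and \<open>1\<close> call for small repairs.

  Counting gives \<open>2 q\<^sup>2 - 1\<close> edges (\<open>card_arcs\<close>) and at most
  \<open>2 q (4 q\<^sup>2 - 1) / 3\<close> odd triangles (\<open>odd_triangles_le\<close> and
  \<open>card_odd_triangle_pairs\<close>), and the quotient of the two numbers is the bound above.
\<close>

section \<open>Isomorphic complexes have equal Cheeger constants\<close>

text \<open>
  Pulling cochains back along an isomorphism of complexes is a bijection that commutes with addition
  and coboundaries and preserves norms. This allows the graph to be built on labelled points instead of
  on \<open>{1..n}\<close>.
\<close>

lemma cheeger_isomorphic:
  assumes bij: "bij_betw F X Y"
    and card: "\<And>\<sigma>. \<sigma> \<in> X \<Longrightarrow> card (F \<sigma>) = card \<sigma>"
    and sub: "\<And>\<sigma> \<tau>. \<sigma> \<in> X \<Longrightarrow> \<tau> \<in> X \<Longrightarrow> F \<sigma> \<subseteq> F \<tau> \<longleftrightarrow> \<sigma> \<subseteq> \<tau>"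
  shows "cheeger k X = cheeger k Y"
proof -
  define pull :: "('b set \<Rightarrow> bit) \<Rightarrow> 'a set \<Rightarrow> bit"
    where "pull c = (\<lambda>\<sigma>. if \<sigma> \<in> X then c (F \<sigma>) else 0)" for c
  have inX: "\<sigma> \<in> X" if "\<sigma> \<in> simplices X k" for \<sigma> k
    using that by (simp add: simplices_def)
  have simp_iff: "F \<sigma> \<in> simplices Y k \<longleftrightarrow> \<sigma> \<in> simplices X k" if "\<sigma> \<in> X" for \<sigma> k
    using that card bij by (auto simp: simplices_def bij_betw_def)
  have preimage: "\<exists>\<sigma>\<in>X. \<tau> = F \<sigma>" if "\<tau> \<in> simplices Y k" for \<tau> k
    using that bij by (auto simp: simplices_def bij_betw_def)
  have inj: "inj_on F X"
    using bij by (simp add: bij_betw_def)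
  have restrict: "bij_betw F {\<sigma>. \<sigma> \<in> simplices X k \<and> P (F \<sigma>)} {\<tau>. \<tau> \<in> simplices Y k \<and> P \<tau>}" for k P
    unfolding bij_betw_def
  proof
    show "inj_on F {\<sigma>. \<sigma> \<in> simplices X k \<and> P (F \<sigma>)}"
      using inj by (rule inj_on_subset) (auto dest: inX)
    show "F ` {\<sigma>. \<sigma> \<in> simplices X k \<and> P (F \<sigma>)} = {\<tau>. \<tau> \<in> simplices Y k \<and> P \<tau>}" (is "?L = ?R")
    proof (intro equalityI subsetI)
      fix \<tau> assume "\<tau> \<in> ?L"
      then obtain \<sigma> where \<sigma>: "\<sigma> \<in> simplices X k" "P (F \<sigma>)" "\<tau> = F \<sigma>" by blast
      then show "\<tau> \<in> ?R" using simp_iff[OF inX[OF \<sigma>(1)], of k] by simp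
    next
      fix \<tau> assume \<tau>: "\<tau> \<in> ?R"
      then obtain \<sigma> where \<sigma>: "\<sigma> \<in> X" "\<tau> = F \<sigma>" using preimage by blast
      with \<tau> show "\<tau> \<in> ?L" using simp_iff[OF \<sigma>(1), of k] by blast
    qed
  qed
  have norm: "cochain_norm X k (pull c) = cochain_norm Y k c" for k c
  proof -
    have "{\<sigma> \<in> simplices X k. pull c \<sigma> = 1} = {\<sigma>. \<sigma> \<in> simplices X k \<and> c (F \<sigma>) = 1}"
      by (auto simp: pull_def dest: inX)
    then show ?thesis
      unfolding cochain_norm_def using bij_betw_same_card[OF restrict[of k "\<lambda>\<tau>. c \<tau> = 1"]] by simp
  qed
  have coboundary_pull: "coboundary X k (pull c) = pull (coboundary Y k c)" for k c
  proof
    fix \<tau>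
    show "coboundary X k (pull c) \<tau> = pull (coboundary Y k c) \<tau>"
    proof (cases "\<tau> \<in> simplices X (k + 1)")
      case True
      have below: "{\<sigma>. \<sigma> \<in> simplices X k \<and> \<sigma> \<subseteq> \<tau>} = {\<sigma>. \<sigma> \<in> simplices X k \<and> F \<sigma> \<subseteq> F \<tau>}"
        using sub[OF _ inX[OF True]] inX by blast
      have "(\<Sum>\<sigma> | \<sigma> \<in> simplices X k \<and> \<sigma> \<subseteq> \<tau>. pull c \<sigma>)
          = (\<Sum>\<sigma> | \<sigma> \<in> simplices X k \<and> \<sigma> \<subseteq> \<tau>. c (F \<sigma>))"
        by (rule sum.cong) (auto simp: pull_def dest: inX)
      also have "\<dots> = (\<Sum>\<sigma> | \<sigma> \<in> simplices Y k \<and> \<sigma> \<subseteq> F \<tau>. c \<sigma>)"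
        unfolding below by (rule sum.reindex_bij_betw[OF restrict])
      finally show ?thesis
        using True simp_iff[of \<tau> "k + 1"] inX[of \<tau>] by (simp add: coboundary_def pull_def)
    next
      case False
      then show ?thesis
        using simp_iff[of \<tau> "k + 1"] by (simp add: coboundary_def pull_def)
    qed
  qed
  have pull_onto: "cochains X k = pull ` cochains Y k" for k
  proof (intro equalityI subsetI)
    fix c assume c: "c \<in> cochains X k"
    define c' where "c' = (\<lambda>\<tau>. if \<tau> \<in> Y then c (inv_into X F \<tau>) else 0)"
    have "c' \<in> cochains Y k"
      using c preimage simp_iff bij
      by (auto simp: cochains_def c'_def bij_betw_def inj)
    moreover have "pull c' = c"
      using c bij by (auto simp: pull_def c'_def bij_betw_def cochains_def simplices_def)
    ultimately show "c \<in> pull ` cochains Y k" by blast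
  next
    fix c assume "c \<in> pull ` cochains Y k"
    then show "c \<in> cochains X k"
      using simp_iff by (auto simp: cochains_def pull_def)
  qed
  have pull_inj: "inj_on pull (cochains Y k)" for k
  proof (rule inj_onI, rule ext)
    fix c c' \<tau>
    assume c: "c \<in> cochains Y k" "c' \<in> cochains Y k" and eq: "pull c = pull c'"
    show "c \<tau> = c' \<tau>"
    proof (cases "\<tau> \<in> simplices Y k")
      case True
      then obtain \<sigma> where "\<sigma> \<in> X" "\<tau> = F \<sigma>" using preimage by blast
      then show ?thesis using fun_cong[OF eq, of \<sigma>] by (simp add: pull_def)
    qed (use c in \<open>auto simp: cochains_def\<close>)
  qed
  have pull_add: "(\<lambda>\<sigma>. pull c \<sigma> + pull c' \<sigma>) = pull (\<lambda>\<sigma>. c \<sigma> + c' \<sigma>)" for c c'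
    by (auto simp: pull_def)
  have csy: "csy_norm X k (pull c) = csy_norm Y k c" for k c
    unfolding csy_norm_def pull_onto image_image coboundary_pull pull_add norm ..
  have "coboundaries X k = pull ` coboundaries Y k"
    unfolding coboundaries_def pull_onto image_image coboundary_pull ..
  then have "cochains X k - coboundaries X k = pull ` (cochains Y k - coboundaries Y k)"
    using inj_on_image_set_diff[OF pull_inj[of k], of "cochains Y k" "coboundaries Y k"]
      coboundaries_subset_cochains[of Y k] pull_onto[of k] by auto
  then show ?thesis
    unfolding cheeger_def by (simp add: image_image coboundary_pull norm csy)
qed

lemma cheeger_full_simplex_card:
  assumes "finite V" "finite W" "card V = card W"
  shows "cheeger k (full_simplex V) = cheeger k (full_simplex W)"
proof -
  obtain f where f: "bij_betw f V W"
    using finite_same_card_bij[OF assms] by blast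
  show ?thesis
  proof (rule cheeger_isomorphic[where F = "image f"])
    show "bij_betw (image f) (full_simplex V) (full_simplex W)"
      using f unfolding full_simplex_def by (rule bij_betw_Pow)
  next
    fix \<sigma> assume "\<sigma> \<in> full_simplex V"
    then have "inj_on f \<sigma>"
      using f by (auto simp: full_simplex_def bij_betw_def intro: inj_on_subset)
    then show "card (f ` \<sigma>) = card \<sigma>" by (rule card_image)
  next
    fix \<sigma> \<tau> assume "\<sigma> \<in> full_simplex V" "\<tau> \<in> full_simplex V"
    then show "f ` \<sigma> \<subseteq> f ` \<tau> \<longleftrightarrow> \<sigma> \<subseteq> \<tau>"
      using inj_on_image_mem_iff[OF bij_betw_imp_inj_on[OF f], of _ \<tau>]
      unfolding full_simplex_def by blast
  qed
qed


section \<open>Bounding the Cheeger constant and the cosystolic norm\<close>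

text \<open>
  A coboundary has cosystolic norm zero, so a positive norm makes the cochain eligible for the minimum.
\<close>

lemma cheeger_le_ratio:
  assumes X: "finite_simplicial_complex X" and c: "c \<in> cochains X k"
    and pos: "csy_norm X k c > 0"
  shows "cheeger k X
    \<le> real (cochain_norm X (k + 1) (coboundary X k c)) / real (csy_norm X k c)"
proof -
  have "c \<notin> coboundaries X k"
  proof
    assume "c \<in> coboundaries X k"
    then obtain d where d: "d \<in> cochains X (k - 1)" "c = coboundary X (k - 1) d"
      by (auto simp: coboundaries_def)
    have "csy_norm X k c \<le> cochain_norm X k (\<lambda>\<sigma>. c \<sigma> + coboundary X (k - 1) d \<sigma>)"
      unfolding csy_norm_def using d(1) finite_cochains[OF X] by (intro Min_le) auto
    also have "\<dots> = 0"
      by (simp add: d(2) cochain_norm_def)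
    finally show False using pos by simp
  qed
  then show ?thesis
    unfolding cheeger_def using c finite_cochains[OF X] by (intro Min_le) auto
qed

text \<open>
  A packing bound: if every cochain in the class of \<open>c\<close> has a one on each of a family of
  disjoint sets of simplices, then choosing such a simplex in each set embeds the index set of the
  family into the support.
\<close>

lemma card_le_csy_norm:
  assumes X: "finite_simplicial_complex X"
    and P: "\<And>e. e \<in> I \<Longrightarrow> P e \<subseteq> simplices X k"
    and disj: "disjoint_family_on P I"
    and meets: "\<And>e d. e \<in> I \<Longrightarrow> d \<in> cochains X (k - 1)
      \<Longrightarrow> \<exists>\<sigma>\<in>P e. c \<sigma> + coboundary X (k - 1) d \<sigma> = 1"
  shows "card I \<le> csy_norm X k c"
proof -
  have "card I \<le> cochain_norm X k (\<lambda>\<sigma>. c \<sigma> + coboundary X (k - 1) d \<sigma>)"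
    if d: "d \<in> cochains X (k - 1)" for d
  proof -
    obtain g where g: "\<And>e. e \<in> I \<Longrightarrow> g e \<in> P e \<and> c (g e) + coboundary X (k - 1) d (g e) = 1"
      using meets[OF _ d] by metis
    have fin: "finite (simplices X k)"
      using X by (simp add: finite_simplicial_complex_def simplices_def)
    have "inj_on g I"
    proof (rule inj_onI, rule ccontr)
      fix e e' assume "e \<in> I" "e' \<in> I" "g e = g e'" "e \<noteq> e'"
      then show False
        using g[of e] g[of e'] disjoint_family_onD[OF disj] by auto
    qed
    then show ?thesis
      unfolding cochain_norm_def by (rule card_inj_on_le) (use g P fin in auto)
  qed
  then show ?thesis
    unfolding csy_norm_def using finite_cochains[OF X] zero_in_cochains[of X "k - 1"]
    by (subst Min_ge_iff) auto
qed

lemma coboundary_edge: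
  assumes "u \<in> V" "v \<in> V" "u \<noteq> v"
  shows "coboundary (full_simplex V) 0 d {u, v} = d {u} + d {v}"
proof -
  have "{\<sigma>. \<sigma> \<in> simplices (full_simplex V) 0 \<and> \<sigma> \<subseteq> {u, v}} = {{u}, {v}}"
    using assms by (auto simp: simplices_def full_simplex_def card_1_singleton_iff)
  then show ?thesis
    using assms by (simp add: coboundary_def simplices_def full_simplex_def)
qed

lemma coboundary_triangle:
  assumes "u \<in> V" "v \<in> V" "w \<in> V" "u \<noteq> v" "u \<noteq> w" "v \<noteq> w"
  shows "coboundary (full_simplex V) 1 c {u, v, w} = c {u, v} + c {u, w} + c {v, w}"
proof -
  have "{\<sigma>. \<sigma> \<in> simplices (full_simplex V) 1 \<and> \<sigma> \<subseteq> {u, v, w}} = {{u, v}, {u, w}, {v, w}}"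
  proof (intro equalityI subsetI)
    fix \<sigma> assume "\<sigma> \<in> {\<sigma>. \<sigma> \<in> simplices (full_simplex V) 1 \<and> \<sigma> \<subseteq> {u, v, w}}"
    then have "card \<sigma> = 2" "\<sigma> \<subseteq> {u, v, w}"
      by (auto simp: simplices_def)
    then obtain x y where "\<sigma> = {x, y}" "x \<noteq> y" by (auto simp: card_2_iff)
    with \<open>\<sigma> \<subseteq> {u, v, w}\<close> show "\<sigma> \<in> {{u, v}, {u, w}, {v, w}}" by auto
  qed (use assms in \<open>auto simp: simplices_def full_simplex_def\<close>)
  moreover have "{u, v} \<noteq> {u, w}" "{u, v} \<noteq> {v, w}" "{u, w} \<noteq> {v, w}"
    using assms by (auto simp: doubleton_eq_iff)
  ultimately show ?thesis
    using assms
    by (cases "c {u, v}"; cases "c {u, w}"; cases "c {v, w}")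
      (simp_all add: coboundary_def simplices_def full_simplex_def)
qed


section \<open>The staircase graph\<close>

text \<open>
  A point is a pair of its block and a copy number within the block. The single points in the blocks
  \<open>0\<close> and \<open>1\<close> bring the number of points from \<open>4 q + 2\<close> down to
  \<open>4 q\<close>, and the number of edges from \<open>2 q (q + 1)\<close> down to
  \<open>2 q\<^sup>2 - 1\<close>.
\<close>

definition copies :: "nat \<Rightarrow> nat set" where
  "copies k = (if k \<le> 1 then {0} else {0, 1})"

definition vertices :: "nat \<Rightarrow> (nat \<times> nat) set" where
  "vertices q = (SIGMA k : {0..2 * q}. copies k)"

text \<open>
  Edges are oriented from the even to the odd block, so that they can serve as the index set of the
  packing.
\<close>

definition arcs :: "nat \<Rightarrow> ((nat \<times> nat) \<times> (nat \<times> nat)) set" where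
  "arcs q = {(u, v). u \<in> vertices q \<and> v \<in> vertices q
     \<and> even (fst u) \<and> odd (fst v) \<and> fst u < fst v}"

definition staircase :: "nat \<Rightarrow> (nat \<times> nat) set \<Rightarrow> bit" where
  "staircase q \<sigma> = of_bool (\<exists>(u, v) \<in> arcs q. \<sigma> = {u, v})"

lemma finite_vertices: "finite (vertices q)"
  by (auto simp: vertices_def copies_def)

lemma card_vertices: "q \<ge> 1 \<Longrightarrow> card (vertices q) = 4 * q"
proof (induction q rule: dec_induct)
  case base
  then show ?case by (simp add: vertices_def copies_def numeral_2_eq_2 atLeast0_atMost_Suc)
next
  case (step q)
  have "{0..2 * Suc q} = insert (2 * q + 2) (insert (2 * q + 1) {0..2 * q})" by auto
  with step show ?case by (simp add: vertices_def copies_def)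
qed

lemma finite_arcs: "finite (arcs q)"
  by (rule finite_subset[of _ "vertices q \<times> vertices q"])
    (auto simp: arcs_def finite_vertices)

lemma staircase_pair:
  assumes "u \<in> vertices q" "v \<in> vertices q" "fst u < fst v"
  shows "staircase q {u, v} = of_bool (even (fst u) \<and> odd (fst v))"
  using assms by (cases u; cases v) (auto simp: staircase_def arcs_def doubleton_eq_iff)

lemma staircase_cochain: "staircase q \<in> cochains (full_simplex (vertices q)) 1"
proof -
  have "\<sigma> \<in> simplices (full_simplex (vertices q)) 1" if "(u, v) \<in> arcs q" "\<sigma> = {u, v}" for u v \<sigma>
  proof -
    have "u \<noteq> v" using that(1) by (auto simp: arcs_def)
    then show ?thesis using that by (simp add: simplices_def full_simplex_def arcs_def)
  qed
  then show ?thesis by (auto simp: cochains_def staircase_def)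
qed


section \<open>A packing of cycles with an odd number of edges\<close>

text \<open>
  The cycle of the edge from \<open>(x, s)\<close> to \<open>(y, t)\<close>, as a set of pairs listed
  with the earlier block first. The generic case is the quadrilateral
  \<open>(x, s), (y, t), (y - x, s), (y + 1, t)\<close>. As \<open>y - x\<close> and
  \<open>y\<close> are odd, \<open>x\<close> and \<open>y + 1\<close> even and \<open>y - x < y + 1\<close>,
  its other three sides are not edges of the graph.
  For \<open>x = 0\<close> the points \<open>(y, t)\<close> and \<open>(y - x, s)\<close> would share a
  block, and the quadrilateral shrinks to a triangle. For \<open>x = y - 1\<close> and
  \<open>s = 1\<close> it would use the point \<open>(1, 1)\<close>, which does not exist; the triangle
  that replaces it uses the pair from \<open>(y, t)\<close> to the opposite copy in block
  \<open>y + 1\<close>, which lies on none of the other cycles, and the pair from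
  \<open>(x, 1)\<close> to that copy, which is left free by the impossible quadrilateral of the edge
  from \<open>(x, 1)\<close> to the other point of block \<open>y\<close>.
\<close>

fun cycle :: "(nat \<times> nat) \<times> (nat \<times> nat) \<Rightarrow> ((nat \<times> nat) \<times> (nat \<times> nat)) set" where
  "cycle ((x, s), (y, t)) =
    (if x = 0 then {((x, s), (y, t)), ((y, t), (y + 1, t)), ((x, s), (y + 1, t))}
     else if x = y - 1 \<and> s = 1
       then {((x, s), (y, t)), ((y, t), (y + 1, 1 - t)), ((x, s), (y + 1, 1 - t))}
     else {((x, s), (y, t)), ((y - x, s), (y, t)), ((y - x, s), (y + 1, t)), ((x, s), (y + 1, t))})"

text \<open>
  The left inverse that recovers the edge from any pair on its cycle. The parities of the two blocks
  tell which side of the cycle the pair is; between blocks \<open>y\<close> and \<open>y + 1\<close>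
  equal copy numbers belong to the triangle with \<open>x = 0\<close> and different ones to the
  triangle with \<open>x = y - 1\<close>.
\<close>

fun owner :: "(nat \<times> nat) \<times> (nat \<times> nat) \<Rightarrow> (nat \<times> nat) \<times> (nat \<times> nat)" where
  "owner ((x, s), (z, r)) =
    (if even x \<and> odd z then ((x, s), (z, r))
     else if odd x \<and> odd z then ((z - x, s), (z, r))
     else if odd x
       then (if z = x + 1 then (if s = r then ((0, 0), (x, s)) else ((x - 1, 1), (x, s)))
             else ((z - 1 - x, s), (z - 1, r)))
     else if x \<noteq> 0 \<and> z = x + 2 \<and> s = 1 then ((x, s), (z - 1, 1 - r))
     else ((x, s), (z - 1, r)))"

lemma arcs_cases:
  assumes "e \<in> arcs q"
  obtains i s j t where "e = ((2 * i, s), (2 * j + 1, t))" "i \<le> j" "j < q"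
    "s \<in> copies (2 * i)" "t \<in> copies (2 * j + 1)"
proof -
  obtain x s y t where e: "e = ((x, s), (y, t))" by (metis prod.collapse)
  then have "even x" "odd y" "x < y" "y \<le> 2 * q" "s \<in> copies x" "t \<in> copies y"
    using assms by (auto simp: arcs_def vertices_def)
  then show thesis
    using that[of "x div 2" s "y div 2" t] e by (auto elim!: evenE oddE)
qed

lemma cycle_cases:
  assumes "e \<in> arcs q"
  obtains
    (least) j t where "e = ((0, 0), (2 * j + 1, t))" "j < q" "t \<in> copies (2 * j + 1)"
      "cycle e = {((0, 0), (2 * j + 1, t)), ((2 * j + 1, t), (2 * j + 2, t)), ((0, 0), (2 * j + 2, t))}"
  | (adjacent) j t where "e = ((2 * j, 1), (2 * j + 1, t))" "0 < j" "j < q" "t \<in> {0, 1}"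
      "cycle e = {((2 * j, 1), (2 * j + 1, t)), ((2 * j + 1, t), (2 * j + 2, 1 - t)),
        ((2 * j, 1), (2 * j + 2, 1 - t))}"
  | (quadrilateral) i s j t where "e = ((2 * i, s), (2 * j + 1, t))" "0 < i" "i \<le> j" "j < q"
      "s \<in> copies (2 * (j - i) + 1)" "s \<in> {0, 1}" "t \<in> {0, 1}"
      "cycle e = {((2 * i, s), (2 * j + 1, t)), ((2 * (j - i) + 1, s), (2 * j + 1, t)),
        ((2 * (j - i) + 1, s), (2 * j + 2, t)), ((2 * i, s), (2 * j + 2, t))}"
  using assms
proof (cases rule: arcs_cases)
  case (1 i s j t)
  consider (1) "i = 0" | (2) "i > 0" "i = j" "s = 1" | (3) "i > 0" "\<not> (i = j \<and> s = 1)"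
    by blast
  then show thesis
  proof cases
    case 1
    then show ?thesis
      using least[of j t] \<open>e = _\<close> \<open>j < q\<close> \<open>s \<in> _\<close> \<open>t \<in> _\<close> by (simp add: copies_def)
  next
    case 2
    then show ?thesis
      using adjacent[of j t] \<open>e = _\<close> \<open>j < q\<close> \<open>t \<in> _\<close> by (simp add: copies_def)
  next
    case 3
    moreover from this have "s \<in> copies (2 * (j - i) + 1)"
      using \<open>i \<le> j\<close> \<open>s \<in> _\<close> by (auto simp: copies_def)
    ultimately show ?thesis
      using quadrilateral[of i s j t] \<open>e = _\<close> \<open>i \<le> j\<close> \<open>j < q\<close> \<open>s \<in> copies (2 * i)\<close> \<open>t \<in> _\<close>
      by (auto simp: copies_def diff_mult_distrib2 Suc_diff_le split: if_splits)
  qed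
qed

text \<open>
  This makes the packing disjoint: a pair of vertices that lies on a cycle determines the edge for
  which the cycle was built.
\<close>

lemma owner_cycle:
  assumes "e \<in> arcs q" "p \<in> cycle e"
  shows "owner p = e"
  using assms(1)
proof (cases rule: cycle_cases)
  case (least j t)
  show ?thesis
    using assms(2) unfolding least by auto
next
  case (adjacent j t)
  show ?thesis
    using assms(2) unfolding adjacent(5) unfolding adjacent(1) using adjacent(2-4) by auto
next
  case (quadrilateral i s j t)
  then have "\<not> (i = j \<and> s = 1)" by (auto simp: copies_def)
  then show ?thesis
    using assms(2) unfolding quadrilateral(8) unfolding quadrilateral(1) using quadrilateral(2-4)
    by auto
qed

lemma cycle_increasing:
  assumes "e \<in> arcs q" "(u, v) \<in> cycle e"
  shows "u \<in> vertices q \<and> v \<in> vertices q \<and> fst u < fst v"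
  using assms(1)
proof (cases rule: cycle_cases)
  case (least j t)
  show ?thesis
    using assms(2) unfolding least using least(2,3)
    by (auto simp: copies_def vertices_def split: if_splits)
next
  case (adjacent j t)
  show ?thesis
    using assms(2) unfolding adjacent(5) using adjacent(2-4)
    by (auto simp: copies_def vertices_def)
next
  case (quadrilateral i s j t)
  show ?thesis
    using assms(2) unfolding quadrilateral(8) using quadrilateral(2-7)
    by (auto simp: copies_def vertices_def)
qed

text \<open>
  The coboundary of a 0-cochain adds up to zero around every closed cycle, so a cochain in the class
  of the graph still has an odd number of ones on each cycle of the packing, hence at least one.
  Disjointness then gives at least as many ones as there are edges: no cochain in the class is
  smaller than the graph itself.
\<close>

lemma card_arcs_le_csy_norm:
  "card (arcs q) \<le> csy_norm (full_simplex (vertices q)) 1 (staircase q)"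
proof (rule card_le_csy_norm[where P = "\<lambda>e. (\<lambda>(u, v). {u, v}) ` cycle e"])
  show "finite_simplicial_complex (full_simplex (vertices q))"
    by (intro finite_simplicial_complex_full_simplex finite_vertices)
next
  fix e assume e: "e \<in> arcs q"
  have "{u, v} \<in> simplices (full_simplex (vertices q)) 1" if "(u, v) \<in> cycle e" for u v
  proof -
    have "u \<noteq> v" using cycle_increasing[OF e that] by auto
    then show ?thesis
      using cycle_increasing[OF e that] by (simp add: simplices_def full_simplex_def)
  qed
  then show "(\<lambda>(u, v). {u, v}) ` cycle e \<subseteq> simplices (full_simplex (vertices q)) 1"
    by auto
next
  show "disjoint_family_on (\<lambda>e. (\<lambda>(u, v). {u, v}) ` cycle e) (arcs q)"
    unfolding disjoint_family_on_def
  proof (intro ballI impI, rule ccontr)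
    fix e e' assume e: "e \<in> arcs q" "e' \<in> arcs q" "e \<noteq> e'"
      and "(\<lambda>(u, v). {u, v}) ` cycle e \<inter> (\<lambda>(u, v). {u, v}) ` cycle e' \<noteq> {}"
    then obtain u v u' v' where uv: "(u, v) \<in> cycle e" "(u', v') \<in> cycle e'" "{u, v} = {u', v'}"
      by auto
    then have "(u, v) = (u', v')"
      using cycle_increasing[OF e(1) uv(1)] cycle_increasing[OF e(2) uv(2)]
      by (auto simp: doubleton_eq_iff)
    then show False
      using e uv owner_cycle by metis
  qed
next
  fix e and d :: "(nat \<times> nat) set \<Rightarrow> bit" assume e: "e \<in> arcs q"
  \<comment> \<open>\<open>D\<close> marks the switched points and \<open>c'\<close> the switched graph.\<close>
  define D where "D v = d {v}" for v
  define c' where "c' \<sigma> = staircase q \<sigma> + coboundary (full_simplex (vertices q)) 0 d \<sigma>" for \<sigma>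
  have c': "c' {u, v} = of_bool (even (fst u) \<and> odd (fst v)) + (D u + D v)"
    if "(u, v) \<in> cycle e" for u v
  proof -
    have "u \<in> vertices q" "v \<in> vertices q" "fst u < fst v" "u \<noteq> v"
      using cycle_increasing[OF e that] by auto
    then show ?thesis
      unfolding c'_def D_def using coboundary_edge[of u "vertices q" v d] staircase_pair[of u q v]
      by metis
  qed
  have "\<exists>(u, v) \<in> cycle e. c' {u, v} = 1"
  proof (rule ccontr)
    assume "\<not> ?thesis"
    then have zero: "of_bool (even (fst u) \<and> odd (fst v)) + (D u + D v) = 0"
      if "(u, v) \<in> cycle e" for u v
    proof -
      have "c' {u, v} \<noteq> 1"
        using \<open>\<not> (\<exists>(u, v) \<in> cycle e. c' {u, v} = 1)\<close> that by blast
      then have "c' {u, v} = 0" by (cases "c' {u, v}") auto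
      then show ?thesis using c'[OF that] by simp
    qed
    \<comment> \<open>Around the cycle every value of \<open>D\<close> is added twice, leaving the single edge.\<close>
    show False
      using e
    proof (cases rule: cycle_cases)
      case (least j t)
      then show False
        using zero[of "(0, 0)" "(2 * j + 1, t)"] zero[of "(2 * j + 1, t)" "(2 * j + 2, t)"]
          zero[of "(0, 0)" "(2 * j + 2, t)"]
        by (cases "D (0, 0)"; cases "D (2 * j + 1, t)"; cases "D (2 * j + 2, t)") auto
    next
      case (adjacent j t)
      then show False
        using zero[of "(2 * j, 1)" "(2 * j + 1, t)"]
          zero[of "(2 * j + 1, t)" "(2 * j + 2, 1 - t)"] zero[of "(2 * j, 1)" "(2 * j + 2, 1 - t)"]
        by (cases "D (2 * j, 1)"; cases "D (2 * j + 1, t)"; cases "D (2 * j + 2, 1 - t)") auto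
    next
      case (quadrilateral i s j t)
      then show False
        using zero[of "(2 * i, s)" "(2 * j + 1, t)"]
          zero[of "(2 * (j - i) + 1, s)" "(2 * j + 1, t)"]
          zero[of "(2 * (j - i) + 1, s)" "(2 * j + 2, t)"]
          zero[of "(2 * i, s)" "(2 * j + 2, t)"]
        by (cases "D (2 * i, s)"; cases "D (2 * j + 1, t)"; cases "D (2 * j + 2, t)";
            cases "D (2 * (j - i) + 1, s)") auto
    qed
  qed
  then obtain u v where "(u, v) \<in> cycle e" "c' {u, v} = 1"
    by blast
  then have "{u, v} \<in> (\<lambda>(u, v). {u, v}) ` cycle e"
      and "staircase q {u, v} + coboundary (full_simplex (vertices q)) (1 - 1) d {u, v} = 1"
    by (force, simp add: c'_def)
  then show "\<exists>\<sigma>\<in>(\<lambda>(u, v). {u, v}) ` cycle e.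
      staircase q \<sigma> + coboundary (full_simplex (vertices q)) (1 - 1) d \<sigma> = 1"
    by (rule bexI[rotated])
qed

section \<open>Counting edges and odd triangles\<close>

text \<open>
  The third points that complete an edge between the blocks \<open>x\<close> and \<open>y\<close> to
  an odd triangle. In a bipartite graph an odd triangle contains exactly one edge, so the third point
  must be joined to neither end, which leaves even blocks after \<open>y\<close> and odd blocks before
  \<open>x\<close>.
\<close>

definition completions :: "nat \<Rightarrow> nat \<Rightarrow> nat \<Rightarrow> (nat \<times> nat) set" where
  "completions q x y = {w \<in> vertices q. even (fst w) \<and> y < fst w \<or> odd (fst w) \<and> fst w < x}"

lemma odd_triangles_le:
  "cochain_norm (full_simplex (vertices q)) 2 (coboundary (full_simplex (vertices q)) 1 (staircase q))
    \<le> card (SIGMA e : arcs q. completions q (fst (fst e)) (fst (snd e)))"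
proof -
  define S where "S = (SIGMA e : arcs q. completions q (fst (fst e)) (fst (snd e)))"
  have "{\<sigma> \<in> simplices (full_simplex (vertices q)) 2.
      coboundary (full_simplex (vertices q)) 1 (staircase q) \<sigma> = 1}
    \<subseteq> (\<lambda>((u, v), w). {u, v, w}) ` S" (is "?T \<subseteq> _")
  proof
    fix \<sigma> assume "\<sigma> \<in> ?T"
    then have \<sigma>: "\<sigma> \<subseteq> vertices q" "card \<sigma> = 3"
        "coboundary (full_simplex (vertices q)) 1 (staircase q) \<sigma> = 1"
      by (auto simp: simplices_def full_simplex_def)
    have "\<exists>u v w. \<sigma> = {u, v, w} \<and> (u, v) \<in> arcs q \<and> u \<noteq> w \<and> v \<noteq> w"
    proof -
      obtain a b c where abc: "\<sigma> = {a, b, c}" "a \<noteq> b" "a \<noteq> c" "b \<noteq> c"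
        using \<sigma>(2) unfolding card_3_iff by blast
      then have "staircase q {a, b} + staircase q {a, c} + staircase q {b, c} = 1"
        using \<sigma> coboundary_triangle[of a "vertices q" b c] by simp
      then have "staircase q {a, b} \<noteq> 0 \<or> staircase q {a, c} \<noteq> 0 \<or> staircase q {b, c} \<noteq> 0"
        by auto
      then obtain u v where uv: "(u, v) \<in> arcs q" "{u, v} = {a, b} \<or> {u, v} = {a, c} \<or> {u, v} = {b, c}"
        by (auto simp: staircase_def)
      have "\<sigma> = insert c {a, b}" "\<sigma> = insert b {a, c}" "\<sigma> = insert a {b, c}"
           "c \<notin> {a, b}" "b \<notin> {a, c}" "a \<notin> {b, c}"
        using abc by auto
      then obtain w where "\<sigma> = insert w {u, v}" "w \<notin> {u, v}"
        using uv(2) by metis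
      then have "\<sigma> = {u, v, w}" "u \<noteq> w" "v \<noteq> w"
        by auto
      then show ?thesis using uv(1) by blast
    qed
    then obtain u v w where uvw: "\<sigma> = {u, v, w}" "(u, v) \<in> arcs q" "u \<noteq> w" "v \<noteq> w" by blast
    have uv: "u \<in> vertices q" "v \<in> vertices q" "even (fst u)" "odd (fst v)" "fst u < fst v"
      using uvw(2) by (auto simp: arcs_def)
    have w: "w \<in> vertices q" using uvw \<sigma> by simp
    have sum: "staircase q {u, v} + staircase q {u, w} + staircase q {v, w} = 1"
      using \<sigma>(3) unfolding uvw(1)
      by (subst (asm) coboundary_triangle) (use uv uvw w in auto)
    have edge: "staircase q {u, v} = 1"
      using uv by (simp add: staircase_pair)
    have "w \<in> completions q (fst u) (fst v)"
    proof (cases "even (fst w)")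
      case True
      then have "staircase q {u, w} = 0"
        using uv by (auto simp: staircase_def arcs_def doubleton_eq_iff)
      then have "\<not> fst w < fst v"
        using sum edge True w uv staircase_pair[of w q v] by (auto simp: insert_commute)
      then show ?thesis
        using True w uv by (auto simp: completions_def intro: le_neq_trans)
    next
      case False
      then have "staircase q {v, w} = 0"
        using uv by (auto simp: staircase_def arcs_def doubleton_eq_iff)
      then have "\<not> fst u < fst w"
        using sum edge False w uv staircase_pair[of u q w] by auto
      then show ?thesis
        using False w uv by (auto simp: completions_def intro: le_neq_trans)
    qed
    then have "((u, v), w) \<in> S"
      using uvw by (simp add: S_def)
    then show "\<sigma> \<in> (\<lambda>((u, v), w). {u, v, w}) ` S"
      by (rule image_eqI[rotated]) (simp add: uvw(1))
  qed
  moreover have "finite S"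
    unfolding S_def by (auto simp: finite_arcs completions_def finite_vertices)
  ultimately have "card ?T \<le> card S"
    by (rule surj_card_le[rotated])
  then show ?thesis
    unfolding cochain_norm_def S_def .
qed


lemma sum_vertices_restrict:
  fixes g :: "nat \<Rightarrow> 'a :: comm_semiring_1"
  assumes "finite K" "K \<subseteq> {0..2 * q}"
  shows "(\<Sum>v | v \<in> vertices q \<and> fst v \<in> K. g (fst v)) = (\<Sum>k\<in>K. of_nat (card (copies k)) * g k)"
proof -
  have "{v. v \<in> vertices q \<and> fst v \<in> K} = (SIGMA k : K. copies k)"
    using assms by (auto simp: vertices_def)
  then have "(\<Sum>v | v \<in> vertices q \<and> fst v \<in> K. g (fst v)) = (\<Sum>(k, s) \<in> (SIGMA k : K. copies k). g k)"
    by (simp add: case_prod_unfold)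
  also have "\<dots> = (\<Sum>k\<in>K. \<Sum>s\<in>copies k. g k)"
    using assms by (subst sum.Sigma) (auto simp: copies_def)
  finally show ?thesis by simp
qed

lemma card_vertices_restrict:
  assumes "finite K" "K \<subseteq> {0..2 * q}"
  shows "card {v \<in> vertices q. fst v \<in> K} = (\<Sum>k\<in>K. card (copies k))"
  using sum_vertices_restrict[OF assms, of "\<lambda>_. 1 :: nat"] by simp

lemma sum_arcs:
  fixes g :: "nat \<Rightarrow> nat \<Rightarrow> 'a :: comm_semiring_1"
  shows "(\<Sum>(u, v) \<in> arcs q. g (fst u) (fst v))
    = (\<Sum>j<q. of_nat (card (copies (2 * j + 1)))
        * (\<Sum>i\<le>j. of_nat (card (copies (2 * i))) * g (2 * i) (2 * j + 1)))"
proof -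
  let ?odd = "(\<lambda>j. 2 * j + 1) ` {..<q}" and ?even = "\<lambda>y. (\<lambda>i. 2 * i) ` {..y div 2}"
  let ?A = "{v. v \<in> vertices q \<and> fst v \<in> ?odd}"
  let ?B = "\<lambda>y. {u. u \<in> vertices q \<and> fst u \<in> ?even y}"
  have "arcs q = (\<lambda>(v, u). (u, v)) ` (SIGMA v : ?A. ?B (fst v))" (is "_ = _ ` ?S")
  proof (intro equalityI subsetI)
    fix e assume "e \<in> arcs q"
    then show "e \<in> (\<lambda>(v, u). (u, v)) ` ?S"
      by (cases rule: arcs_cases) (auto simp: vertices_def image_iff)
  next
    fix e assume "e \<in> (\<lambda>(v, u). (u, v)) ` ?S"
    then show "e \<in> arcs q"
      by (auto simp: arcs_def vertices_def)
  qed
  then have "(\<Sum>(u, v) \<in> arcs q. g (fst u) (fst v))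
      = (\<Sum>(v, u) \<in> ?S. g (fst u) (fst v))"
    by (simp only:) (subst sum.reindex, auto simp: inj_on_def case_prod_unfold)
  also have "\<dots> = (\<Sum>v\<in>?A. \<Sum>u\<in>?B (fst v). g (fst u) (fst v))"
    by (subst sum.Sigma) (auto simp: finite_vertices)
  also have "\<dots> = (\<Sum>v\<in>?A. \<Sum>x\<in>?even (fst v). of_nat (card (copies x)) * g x (fst v))"
  proof (rule sum.cong[OF refl])
    fix v assume "v \<in> ?A"
    then have "?even (fst v) \<subseteq> {0..2 * q}" by auto
    then show "(\<Sum>u\<in>?B (fst v). g (fst u) (fst v))
        = (\<Sum>x\<in>?even (fst v). of_nat (card (copies x)) * g x (fst v))"
      using sum_vertices_restrict[of "?even (fst v)" q "\<lambda>x. g x (fst v)"] by simp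
  qed
  also have "\<dots> = (\<Sum>y\<in>?odd. of_nat (card (copies y))
      * (\<Sum>x\<in>?even y. of_nat (card (copies x)) * g x y))"
    by (rule sum_vertices_restrict[of ?odd q
        "\<lambda>y. \<Sum>x\<in>?even y. of_nat (card (copies x)) * g x y"]) auto
  also have "\<dots> = (\<Sum>j<q. of_nat (card (copies (2 * j + 1)))
      * (\<Sum>i\<le>j. of_nat (card (copies (2 * i))) * g (2 * i) (2 * j + 1)))"
    by (simp add: sum.reindex inj_on_def)
  finally show ?thesis .
qed

text \<open>
  The subtraction of natural numbers is meant to truncate here: before block \<open>2 * i\<close> there are
  \<open>2 * i - 1\<close> points in odd blocks if \<open>i\<close> is positive, and none if it is zero.
\<close>

lemma sum_below:
  "(\<Sum>i\<le>j. real (card (copies (2 * i))) * (C + real (2 * i - 1)))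
    = (2 * real j + 1) * C + 2 * (real j)\<^sup>2"
proof (induction j)
  case (Suc j)
  have "card (copies (2 * Suc j)) = 2" by (simp add: copies_def)
  with Suc show ?case by (simp add: algebra_simps power2_eq_square)
qed (simp add: copies_def)

lemma card_arcs:
  assumes "q \<ge> 1"
  shows "real (card (arcs q)) = 2 * (real q)\<^sup>2 - 1"
proof -
  have inner: "(\<Sum>i\<le>j. real (card (copies (2 * i)))) = 2 * real j + 1" for j
    by (induction j) (simp_all add: copies_def)
  have "real (card (arcs q)) = (\<Sum>(u, v) \<in> arcs q. 1)"
    by (simp add: case_prod_unfold)
  also have "\<dots> = (\<Sum>j<q. real (card (copies (2 * j + 1))) * (2 * real j + 1))"
    using sum_arcs[of "\<lambda>_ _. 1 :: real" q] inner by simp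
  also have "\<dots> = 2 * (real q)\<^sup>2 - 1"
    using assms
    by (induction q rule: dec_induct)
      (simp_all add: copies_def algebra_simps power2_eq_square)
  finally show ?thesis .
qed

lemma card_completions:
  assumes "i \<le> j" "j < q"
  shows "card (completions q (2 * i) (2 * j + 1)) = 2 * (q - j) + (2 * i - 1)"
proof -
  let ?later = "(\<lambda>k. 2 * k) ` {j<..q}" and ?earlier = "(\<lambda>k. 2 * k + 1) ` {..<i}"
  have "completions q (2 * i) (2 * j + 1) = {w \<in> vertices q. fst w \<in> ?later \<union> ?earlier}"
    using assms by (auto simp: completions_def vertices_def image_iff elim!: evenE oddE) presburger
  then have "card (completions q (2 * i) (2 * j + 1)) = (\<Sum>k \<in> ?later \<union> ?earlier. card (copies k))"
    using assms by (simp only:) (rule card_vertices_restrict, auto)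
  also have "\<dots> = (\<Sum>k\<in>?later. card (copies k)) + (\<Sum>k\<in>?earlier. card (copies k))"
    by (rule sum.union_disjoint) (auto, presburger)
  also have "(\<Sum>k\<in>?later. card (copies k)) = 2 * (q - j)"
    by (simp add: sum.reindex inj_on_def copies_def)
  also have "(\<Sum>k\<in>?earlier. card (copies k)) = 2 * i - 1"
  proof -
    have "(\<Sum>k<i. card (copies (2 * k + 1))) = 2 * i - 1"
      by (induction i) (auto simp: copies_def)
    then show ?thesis by (simp add: sum.reindex inj_on_def)
  qed
  finally show ?thesis .
qed

lemma card_odd_triangle_pairs:
  assumes "q \<ge> 1"
  shows "real (card (SIGMA e : arcs q. completions q (fst (fst e)) (fst (snd e))))
    = 2 * real q * (4 * (real q)\<^sup>2 - 1) / 3"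
proof -
  have "real (card (SIGMA e : arcs q. completions q (fst (fst e)) (fst (snd e))))
      = (\<Sum>(u, v) \<in> arcs q. real (card (completions q (fst u) (fst v))))"
    by (subst card_SigmaI) (auto simp: finite_arcs completions_def finite_vertices case_prod_unfold)
  also have "\<dots> = (\<Sum>j<q. real (card (copies (2 * j + 1)))
      * (\<Sum>i\<le>j. real (card (copies (2 * i))) * (2 * (real q - real j) + real (2 * i - 1))))"
  proof (subst sum_arcs, intro sum.cong refl arg_cong2[where f = "(*)"])
    fix i j assume "j \<in> {..<q}" "i \<in> {..j}"
    then show "real (card (completions q (2 * i) (2 * j + 1)))
        = 2 * (real q - real j) + real (2 * i - 1)"
      by (subst card_completions) (simp_all only: lessThan_iff atMost_iff of_nat_add of_nat_mult of_nat_diff of_nat_numeral less_imp_le)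
  qed
  also have "\<dots> = (\<Sum>j<q. real (card (copies (2 * j + 1)))
      * ((2 * real j + 1) * (2 * (real q - real j)) + 2 * (real j)\<^sup>2))"
    by (simp only: sum_below)
  also have "\<dots> = 2 * real q * (4 * (real q)\<^sup>2 - 1) / 3"
  proof -
    \<comment> \<open>The summand depends on \<open>q\<close>, so the induction runs over a separate upper limit.
      The final \<open>2 * real q\<close> accounts for the missing second point of block 1.\<close>
    have "(\<Sum>j<p. real (card (copies (2 * j + 1)))
        * ((2 * real j + 1) * (2 * (real q - real j)) + 2 * (real j)\<^sup>2))
      = 2 * (2 * real q * (real p)\<^sup>2 - real p * (real p - 1) * (real p + 1) * 2 / 3) 
        - 2 * real q" if "p \<ge> 1" for p
      using that
      by (induction p rule: dec_induct)
        (simp_all add: copies_def field_simps power2_eq_square)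
    from this[OF assms] show ?thesis
      by (simp add: field_simps power2_eq_square)
  qed
  finally show ?thesis .
qed


section \<open>The upper bound\<close>

lemma cheeger_simplex_le:
  assumes "q \<ge> 1" "n = 4 * q"
  shows "cheeger 1 (full_simplex {1..n}) \<le> real n * ((real n)\<^sup>2 - 4) / (3 * ((real n)\<^sup>2 - 8))"
proof -
  let ?X = "full_simplex (vertices q)"
  let ?T = "2 * real q * (4 * (real q)\<^sup>2 - 1) / 3" and ?E = "2 * (real q)\<^sup>2 - 1"
  have q: "(real q)\<^sup>2 \<ge> 1" using assms(1) by simp
  have E: "?E \<le> real (csy_norm ?X 1 (staircase q))"
    using card_arcs[OF assms(1)] card_arcs_le_csy_norm[of q] by linarith
  have T: "real (cochain_norm ?X 2 (coboundary ?X 1 (staircase q))) \<le> ?T"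
    using card_odd_triangle_pairs[OF assms(1)] odd_triangles_le[of q] by linarith
  have "cheeger 1 (full_simplex {1..n}) = cheeger 1 ?X"
    using assms card_vertices[of q] by (intro cheeger_full_simplex_card finite_vertices) auto
  also have "\<dots> \<le> real (cochain_norm ?X (1 + 1) (coboundary ?X 1 (staircase q)))
      / real (csy_norm ?X 1 (staircase q))"
    using E q
    by (intro cheeger_le_ratio finite_simplicial_complex_full_simplex finite_vertices
        staircase_cochain) auto
  also have "\<dots> \<le> ?T / ?E"
    using E T q by (intro frac_le) auto
  also have "\<dots> = real n * ((real n)\<^sup>2 - 4) / (3 * ((real n)\<^sup>2 - 8))"
    using q assms(2) by (simp add: field_simps power2_eq_square)
  finally show ?thesis .
qed

text \<open>A geometric series with ratio \<open>8 / x\<^sup>2\<close>.\<close>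

lemma sums_reciprocal_expansion:
  fixes x :: real
  assumes "x > 0" "x\<^sup>2 > 8"
  shows "(\<lambda>k. 4 * 8 ^ k * x powi (- (2 * int k + 1))) sums (4 * x / (x\<^sup>2 - 8))"
proof -
  have "(\<lambda>k. 4 / x * (8 / x\<^sup>2) ^ k) sums (4 / x * (1 / (1 - 8 / x\<^sup>2)))"
    by (rule sums_mult, rule geometric_sums) (use assms in simp)
  moreover have "4 / x * (8 / x\<^sup>2) ^ k = 4 * 8 ^ k * x powi (- (2 * int k + 1))" for k
  proof -
    have "x powi (2 * int k + 1) = x ^ (2 * k + 1)"
      using power_int_of_nat[of x "2 * k + 1"] by (simp add: ac_simps)
    then show ?thesis
      by (simp only: power_int_minus) (simp add: power_mult power_divide divide_inverse power_inverse)
  qed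
  moreover have "4 / x * (1 / (1 - 8 / x\<^sup>2)) = 4 * x / (x\<^sup>2 - 8)"
    using assms by (simp add: field_simps power2_eq_square)
  ultimately show ?thesis by simp
qed

theorem theorem4p6:
  fixes d n :: nat
  assumes "d \<ge> 3" and "n = 2 ^ d"
  shows "cheeger 1 (full_simplex {1..n}) - real n / 3
           \<le> 4 * real n / (3 * ((real n)\<^sup>2 - 8))
       \<and> 4 * real n / (3 * ((real n)\<^sup>2 - 8))
           = 4 / (3 * real n) + 32 / (3 * real n * ((real n)\<^sup>2 - 8))
       \<and> summable (\<lambda>k. 4 * 8 ^ k * real n powi (- (2 * int k + 1)))
       \<and> 4 / (3 * real n) + 32 / (3 * real n * ((real n)\<^sup>2 - 8))
           = 1 / 3 * (\<Sum>k. 4 * 8 ^ k * real n powi (- (2 * int k + 1)))"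
proof -
  have d: "n = 4 * 2 ^ (d - 2)"
  proof -
    have "d = 2 + (d - 2)" using assms(1) by simp
    then have "n = 2 ^ (2 + (d - 2))" using assms(2) by (simp only:)
    then show ?thesis by (simp only: power_add) simp
  qed
  have "(2 :: nat) ^ 3 \<le> 2 ^ d"
    using assms(1) by (intro power_increasing) auto
  then have "8 \<le> n"
    using assms(2) by simp
  then have n: "real n \<ge> 8"
    by simp
  then have n2: "(real n)\<^sup>2 > 8"
    using power_mono[of 8 "real n" 2] by simp
  have "cheeger 1 (full_simplex {1..n}) \<le> real n * ((real n)\<^sup>2 - 4) / (3 * ((real n)\<^sup>2 - 8))"
    using cheeger_simplex_le[OF _ d] by simp
  also have "\<dots> = real n / 3 + 4 * real n / (3 * ((real n)\<^sup>2 - 8))"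
    using n2 by (simp add: field_simps power2_eq_square)
  finally have bound: "cheeger 1 (full_simplex {1..n}) - real n / 3
      \<le> 4 * real n / (3 * ((real n)\<^sup>2 - 8))"
    by simp
  have split: "4 * real n / (3 * ((real n)\<^sup>2 - 8))
      = 4 / (3 * real n) + 32 / (3 * real n * ((real n)\<^sup>2 - 8))"
  proof -
    have "real n \<noteq> 0" "(real n)\<^sup>2 - 8 \<noteq> 0" using n n2 by auto
    then show ?thesis by (simp add: divide_simps) (simp add: algebra_simps power2_eq_square)
  qed
  have series: "(\<lambda>k. 4 * 8 ^ k * real n powi (- (2 * int k + 1))) sums (4 * real n / ((real n)\<^sup>2 - 8))"
    using n n2 by (intro sums_reciprocal_expansion) auto
  have "4 * real n / (3 * ((real n)\<^sup>2 - 8)) = 1 / 3 * (4 * real n / ((real n)\<^sup>2 - 8))"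
    using n2 by (simp add: divide_simps)
  also have "\<dots> = 1 / 3 * (\<Sum>k. 4 * 8 ^ k * real n powi (- (2 * int k + 1)))"
    by (simp only: sums_unique[OF series])
  finally have sum: "4 * real n / (3 * ((real n)\<^sup>2 - 8))
      = 1 / 3 * (\<Sum>k. 4 * 8 ^ k * real n powi (- (2 * int k + 1)))" .
  show ?thesis
    by (intro conjI bound split sums_summable[OF series] trans[OF split[symmetric] sum])
qed

end
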